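(* Let $h>0$ be such that $$\sigma_{\max}+4h\,w_{\max}\,|\mathcal{N}_{\max}^{\mathrm{out}}|<1,$$ where $\sigma_{\max}=\max_{i}\sigma_i$, $w_{\max}=\max_{i\in\{1,\dots,N\}}w_i^{\max}$ with $w_i^{\max}=\max_{j\in\mathcal{N}_i^{\mathrm{out}}}w_{ij}$, and $|\mathcal{N}_{\max}^{\mathrm{out}}|=\max_{i\in\{1,\dots,N\}}|\mathcal{N}_i^{\mathrm{out}}|$. Consider $N$ agents with dynamics $\dot x_i(t)=u_i(t)$, $x_i(t)\in\mathbb{R}$, and control law $u_i(t)=-\sum_{j\in\mathcal{N}_i^{\mathrm{out}}}w_{ij}(\hat x_i(t)-\hat x_j(t))$, $i\in\{1,\dots,N\}$, executing the periodic event-triggered communication and control law with sampling period $h$ (defined in the context) over a weight-balanced, strongly connected digraph $\mathcal{G}$. Then all agents exponentially converge to the average of the initial states $\frac1N\sum_{i=1}^Nx_i(0)$.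
   Context: A weighted digraph $\mathcal{G}=(V,E,W)$ has vertices $V=\{1,\dots,N\}$, directed edges $E\subset V\times V$ and weighted adjacency matrix $W=(w_{ij})\in\mathbb{R}_{\ge0}^{N\times N}$ with $w_{ij}>0$ if $(i,j)\in E$ and $w_{ij}=0$ otherwise. If $(i,j)\in E$, $j$ is an out-neighbor of $i$ and $i$ an in-neighbor of $j$; $\mathcal{N}_i^{\mathrm{out}}$ and $\mathcal{N}_i^{\mathrm{in}}$ are the sets of out- and in-neighbors of $i$, and $d_i^{\mathrm{out}}=\sum_{j\in\mathcal{N}_i^{\mathrm{out}}}w_{ij}$. The digraph is weight-balanced if $\sum_{j\in\mathcal{N}_i^{\mathrm{out}}}w_{ij}=\sum_{j\in\mathcal{N}_i^{\mathrm{in}}}w_{ji}$ for every $i$, and strongly connected if there is a directed path from every vertex to every other. Exponential convergence to the average means that there exist constants $c,\alpha>0$ with $|x_i(t)-\frac1N\sum_{k}x_k(0)|\le c\,e^{-\alpha t}$ for all $t\ge0$ and all $i$. Communication: agent $i$ sends information to the agents in $\mathcal{N}_i^{\mathrm{in}}$ and receives information from the agents in $\mathcal{N}_i^{\mathrm{out}}$; broadcasts are received instantaneously. $\hat x_i(t)$ denotes the last broadcast state of agent $i$ at time $t\ge0$, so it is constant between consecutive broadcasts of agent $i$ and is reset to the current state $x_i$ when $i$ broadcasts. Set $e_i(t)=\hat x_i(t)-x_i(t)$. For design parameters $\sigma_i\in(0,1)$, define $$\phi_i=\sum_{j\in\mathcal{N}_i^{\mathrm{out}}}w_{ij}(\hat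 x_i-\hat x_j)^2,\qquad f_i(e_i)=e_i^2-\frac{\sigma_i}{4d_i^{\mathrm{out}}}\phi_i .$$ Periodic event-triggered communication and control law with sampling period $h$: at the times $t_\ell=\ell h$, $\ell\in\{0,1,2,\dots\}$, each agent $i$ does the following. (1) If $f_i(e_i(t_\ell))>0$, or if $f_i(e_i(t_\ell))=0$ and $\phi_i(t_\ell)\ne0$, then agent $i$ broadcasts its state $x_i(t_\ell)$ (which resets $e_i$ to $0$) and updates its control signal. (2) If new information $x_j(t_\ell)$ is received from some neighbor(s) $j\in\mathcal{N}_i^{\mathrm{out}}$, agent $i$ updates its control signal. No broadcasts occur between sampling times, so $\hat x$ is constant on each $[t_\ell,t_{\ell+1})$. The law is understood to enforce $f_i(e_i(t_\ell))\le0$ for all $i\in\{1,\dots,N\}$ and all $\ell\in\{0,1,2,\dots\}$, where the quantities $e_i(t_\ell)$ and $\hat x(t_\ell)$ are those resulting from the broadcasts at time $t_\ell$ (i.e., the values used on $[t_\ell,t_{\ell+1})$); this condition is not guaranteed at times between sampling instants. *)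

theory Defs
  imports "HOL-Analysis.Analysis"
begin

text \<open>
  The vertex set \<open>{1, \<dots>, N}\<close> is a finite type \<open>'n\<close> with \<open>N = CARD('n)\<close>. As in the general
  notion of a digraph, self-loops are not excluded.
\<close>

definition weighted_digraph :: "('n::finite \<times> 'n) set \<Rightarrow> real^'n^'n \<Rightarrow> bool" where
  "weighted_digraph E W \<longleftrightarrow>
     (\<forall>i j. ((i, j) \<in> E \<longrightarrow> W $ i $ j > 0) \<and> ((i, j) \<notin> E \<longrightarrow> W $ i $ j = 0))"

definition out_nbrs :: "('n \<times> 'n) set \<Rightarrow> 'n \<Rightarrow> 'n set" where
  "out_nbrs E i = {j. (i, j) \<in> E}"

definition in_nbrs :: "('n \<times> 'n) set \<Rightarrow> 'n \<Rightarrow> 'n set" where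
  "in_nbrs E i = {j. (j, i) \<in> E}"

definition d_out :: "('n::finite \<times> 'n) set \<Rightarrow> real^'n^'n \<Rightarrow> 'n \<Rightarrow> real" where
  "d_out E W i = (\<Sum>j\<in>out_nbrs E i. W $ i $ j)"

definition weight_balanced :: "('n::finite \<times> 'n) set \<Rightarrow> real^'n^'n \<Rightarrow> bool" where
  "weight_balanced E W \<longleftrightarrow>
     (\<forall>i. (\<Sum>j\<in>out_nbrs E i. W $ i $ j) = (\<Sum>j\<in>in_nbrs E i. W $ j $ i))"

definition strongly_connected :: "('n \<times> 'n) set \<Rightarrow> bool" where
  "strongly_connected E \<longleftrightarrow> (\<forall>i j. (i, j) \<in> E\<^sup>*)"

text \<open>
  If strongly connected with \<open>N \<ge> 2\<close>, every vertex has an out-neighbour, so the inner maximum is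
  over a nonempty set. For a single vertex without self-loop \<open>w_max\<close> is unspecified, but it is
  only ever used multiplied by \<open>nbrs_max = 0\<close>.
\<close>

definition w_max :: "('n::finite \<times> 'n) set \<Rightarrow> real^'n^'n \<Rightarrow> real" where
  "w_max E W = (MAX i\<in>UNIV. MAX j\<in>out_nbrs E i. W $ i $ j)"

definition nbrs_max :: "('n::finite \<times> 'n) set \<Rightarrow> nat" where
  "nbrs_max E = (MAX i\<in>UNIV. card (out_nbrs E i))"

definition phi :: "('n::finite \<times> 'n) set \<Rightarrow> real^'n^'n \<Rightarrow> real^'n \<Rightarrow> 'n \<Rightarrow> real" where
  "phi E W xh i = (\<Sum>j\<in>out_nbrs E i. W $ i $ j * (xh $ i - xh $ j)\<^sup>2)"

text \<open>
  In \<open>trigger_fun E W \<sigma> x xh i\<close>, \<open>x\<close> is the current state and \<open>xh\<close> the vector of last broadcast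
  states, so that \<open>e\<^sub>i = xh $ i - x $ i\<close>. When \<open>d_out E W i = 0\<close> (only possible for a single
  vertex without self-loop in the strongly connected case) the value is \<open>e\<^sub>i\<^sup>2\<close>.
\<close>

definition trigger_fun ::
  "('n::finite \<times> 'n) set \<Rightarrow> real^'n^'n \<Rightarrow> ('n \<Rightarrow> real) \<Rightarrow> real^'n \<Rightarrow> real^'n \<Rightarrow> 'n \<Rightarrow> real" where
  "trigger_fun E W \<sigma> x xh i =
     (xh $ i - x $ i)\<^sup>2 - \<sigma> i / (4 * d_out E W i) * phi E W xh i"

definition triggered ::
  "('n::finite \<times> 'n) set \<Rightarrow> real^'n^'n \<Rightarrow> ('n \<Rightarrow> real) \<Rightarrow> real^'n \<Rightarrow> real^'n \<Rightarrow> 'n \<Rightarrow> bool" where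
  "triggered E W \<sigma> x xh i \<longleftrightarrow>
     trigger_fun E W \<sigma> x xh i > 0 \<or> (trigger_fun E W \<sigma> x xh i = 0 \<and> phi E W xh i \<noteq> 0)"

text \<open>
  A broadcast by agent \<open>i\<close> changes \<open>phi\<close> at its in-neighbours and may thereby trigger them at the
  same sampling instant. \<open>broadcasts E W \<sigma> x xh xh'\<close> says that \<open>xh'\<close> arises from \<open>xh\<close> by finitely
  many instantaneous rounds, the state being frozen at \<open>x\<close>, in each of which some set \<open>B\<close> of
  agents triggered at that moment broadcast simultaneously. Only triggered agents ever broadcast.
\<close>

inductive broadcasts ::
  "('n::finite \<times> 'n) set \<Rightarrow> real^'n^'n \<Rightarrow> ('n \<Rightarrow> real) \<Rightarrow> real^'n \<Rightarrow> real^'n \<Rightarrow> real^'n \<Rightarrow> bool"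
  for E W \<sigma> x xh where
  start: "broadcasts E W \<sigma> x xh xh"
| round: "broadcasts E W \<sigma> x xh v \<Longrightarrow> \<forall>i\<in>B. triggered E W \<sigma> x v i \<Longrightarrow>
    broadcasts E W \<sigma> x xh (\<chi> i. if i \<in> B then x $ i else v $ i)"

text \<open>
  One sampling instant, from the memory \<open>xh\<close> just before it to the memory \<open>xh'\<close> resulting from
  it: every agent triggered on arrival broadcasts, and the rounds go on at least until
  \<open>f\<^sub>i(e\<^sub>i) \<le> 0\<close> holds for all agents.
\<close>

definition sampling_update ::
  "('n::finite \<times> 'n) set \<Rightarrow> real^'n^'n \<Rightarrow> ('n \<Rightarrow> real) \<Rightarrow> real^'n \<Rightarrow> real^'n \<Rightarrow> real^'n \<Rightarrow> bool" where
  "sampling_update E W \<sigma> x xh xh' \<longleftrightarrow>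
     broadcasts E W \<sigma> x xh xh' \<and>
     (\<forall>i. triggered E W \<sigma> x xh i \<longrightarrow> xh' $ i = x $ i) \<and>
     (\<forall>i. trigger_fun E W \<sigma> x xh' i \<le> 0)"

text \<open>
  The vector \<open>xh0\<close> is the content of the broadcast memory just before time \<open>0\<close>. It is arbitrary;
  in particular it may be \<open>x 0\<close>.
\<close>

definition periodic_event_triggered_law ::
  "('n::finite \<times> 'n) set \<Rightarrow> real^'n^'n \<Rightarrow> ('n \<Rightarrow> real) \<Rightarrow> real \<Rightarrow> real^'n \<Rightarrow>
   (real \<Rightarrow> real^'n) \<Rightarrow> (real \<Rightarrow> real^'n) \<Rightarrow> bool" where
  "periodic_event_triggered_law E W \<sigma> h xh0 x xh \<longleftrightarrow>
     sampling_update E W \<sigma> (x 0) xh0 (xh 0) \<and>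
     (\<forall>l::nat. sampling_update E W \<sigma> (x (real (Suc l) * h)) (xh (real l * h)) (xh (real (Suc l) * h))) \<and>
     (\<forall>l::nat. \<forall>t\<in>{real l * h..<real (Suc l) * h}. xh t = xh (real l * h))"

definition control :: "('n::finite \<times> 'n) set \<Rightarrow> real^'n^'n \<Rightarrow> real^'n \<Rightarrow> 'n \<Rightarrow> real" where
  "control E W xh i = - (\<Sum>j\<in>out_nbrs E i. W $ i $ j * (xh $ i - xh $ j))"

text \<open>
  The control signal jumps at the sampling instants, so the differential equation is required
  strictly between them, and the state is continuous throughout.
\<close>

definition single_integrator ::
  "real \<Rightarrow> (real \<Rightarrow> real^'n::finite) \<Rightarrow> (real \<Rightarrow> 'n \<Rightarrow> real) \<Rightarrow> bool" where
  "single_integrator h x u \<longleftrightarrow>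
     continuous_on {0..} x \<and>
     (\<forall>l::nat. \<forall>t\<in>{real l * h<..<real (Suc l) * h}. \<forall>i.
        ((\<lambda>s. x s $ i) has_real_derivative u t i) (at t))"

definition exp_converges_to_average :: "(real \<Rightarrow> real^'n::finite) \<Rightarrow> bool" where
  "exp_converges_to_average x \<longleftrightarrow>
     (\<exists>c>0. \<exists>\<alpha>>0. \<forall>t\<ge>0. \<forall>i.
        \<bar>x t $ i - (\<Sum>k\<in>UNIV. x 0 $ k) / real CARD('n)\<bar> \<le> c * exp (- \<alpha> * t))"

end

theory Submission
  imports Defs
begin

text \<open>
  On each sampling interval the state moves affinely, \<open>x(t) = x(t\<^sub>l) + (t - t\<^sub>l) u\<close>, and
  weight balance makes \<open>\<Sum>\<^sub>i u\<^sub>i\<close> vanish, so the average \<open>a\<close> is preserved. Put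
  \<open>V(x) = \<Sum>\<^sub>i (x\<^sub>i - a)\<^sup>2\<close> and \<open>\<Phi> = \<Sum>\<^sub>i \<phi>\<^sub>i\<close>. For the broadcast state \<open>v\<close>, weight
  balance gives \<open>\<Sum>\<^sub>i v\<^sub>i u\<^sub>i = - \<Phi> / 2\<close>, Young's inequality and the trigger condition give \<open>- e\<^sub>i u\<^sub>i \<le> (\<sigma>\<^sub>i + 1) \<phi>\<^sub>i / 4\<close>, and Cauchy-Schwarz
  gives \<open>u\<^sub>i\<^sup>2 \<le> d\<^sub>i \<phi>\<^sub>i\<close>. Expanding the square, \<open>V\<close> drops by at least a fixed multiple of \<open>\<Phi>\<close>
  in each sampling period. Strong connectivity and the trigger condition bound \<open>V\<close> by a multiple
  of \<open>\<Phi>\<close>, so \<open>V\<close> decays geometrically along the sampling instants. Between them, \<open>x(t)\<close> is a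
  convex combination of the two neighbouring samples.
\<close>

section \<open>Neighbour sums and weight balance\<close>

lemma weighted_digraph_nonneg:
  assumes "weighted_digraph E W"
  shows "W $ i $ j \<ge> 0"
  using assms unfolding weighted_digraph_def by (cases "(i, j) \<in> E") (auto intro: less_imp_le)

text \<open>Weights vanish off \<open>E\<close>, so neighbour sums extend to all vertices, where
  double sums can be swapped.\<close>

lemma sum_out_nbrs:
  fixes g :: "'n::finite \<Rightarrow> real"
  assumes "weighted_digraph E W"
  shows "(\<Sum>j\<in>out_nbrs E i. W $ i $ j * g j) = (\<Sum>j\<in>UNIV. W $ i $ j * g j)"
  by (rule sum.mono_neutral_left) (use assms in \<open>auto simp: weighted_digraph_def out_nbrs_def\<close>)

lemma d_out_eq_sum:
  assumes "weighted_digraph E W"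
  shows "d_out E W i = (\<Sum>j\<in>UNIV. W $ i $ j)"
  using sum_out_nbrs[OF assms, of i "\<lambda>_. 1"] by (simp add: d_out_def)

lemma phi_eq_sum:
  assumes "weighted_digraph E W"
  shows "phi E W v i = (\<Sum>j\<in>UNIV. W $ i $ j * (v $ i - v $ j)\<^sup>2)"
  unfolding phi_def by (rule sum_out_nbrs[OF assms])

lemma control_eq_sum:
  assumes "weighted_digraph E W"
  shows "control E W v i = - (\<Sum>j\<in>UNIV. W $ i $ j * (v $ i - v $ j))"
  unfolding control_def by (simp only: sum_out_nbrs[OF assms])

lemma phi_nonneg:
  assumes "weighted_digraph E W"
  shows "phi E W v i \<ge> 0"
  unfolding phi_eq_sum[OF assms]
  by (intro sum_nonneg mult_nonneg_nonneg weighted_digraph_nonneg[OF assms]) simp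

lemma d_out_nonneg:
  assumes "weighted_digraph E W"
  shows "d_out E W i \<ge> 0"
  unfolding d_out_eq_sum[OF assms] by (intro sum_nonneg weighted_digraph_nonneg[OF assms])

text \<open>Each \<open>g i\<close> enters with the row sum of \<open>W\<close> at \<open>i\<close>
  minus the column sum, and balance equates the two. It is used for \<open>v $ i\<close> and for its
  square.\<close>

lemma weight_balanced_sum_diff:
  fixes g :: "'n::finite \<Rightarrow> real"
  assumes wd: "weighted_digraph E W" and "weight_balanced E W"
  shows "(\<Sum>i\<in>UNIV. \<Sum>j\<in>UNIV. W $ i $ j * (g i - g j)) = 0"
proof -
  have bal: "(\<Sum>j\<in>UNIV. W $ i $ j) = (\<Sum>j\<in>UNIV. W $ j $ i)" for i
  proof -
    have "(\<Sum>j\<in>in_nbrs E i. W $ j $ i) = (\<Sum>j\<in>UNIV. W $ j $ i)"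
      by (rule sum.mono_neutral_left) (use wd in \<open>auto simp: weighted_digraph_def in_nbrs_def\<close>)
    moreover have "(\<Sum>j\<in>out_nbrs E i. W $ i $ j) = (\<Sum>j\<in>UNIV. W $ i $ j)"
      using d_out_eq_sum[OF wd] by (simp add: d_out_def)
    ultimately show ?thesis
      using assms(2) by (simp add: weight_balanced_def)
  qed
  have "(\<Sum>i\<in>UNIV. \<Sum>j\<in>UNIV. W $ i $ j * g j) = (\<Sum>j\<in>UNIV. \<Sum>i\<in>UNIV. W $ i $ j * g j)"
    by (rule sum.swap)
  also have "\<dots> = (\<Sum>j\<in>UNIV. \<Sum>i\<in>UNIV. W $ j $ i * g j)"
    by (simp only: sum_distrib_right[symmetric] bal)
  finally show ?thesis
    by (simp add: right_diff_distrib sum_subtractf)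
qed

lemma sum_control_eq_0:
  assumes "weighted_digraph E W" "weight_balanced E W"
  shows "(\<Sum>i\<in>UNIV. control E W v i) = 0"
  using weight_balanced_sum_diff[OF assms, of "\<lambda>i. v $ i"]
  by (simp add: control_eq_sum[OF assms(1)] sum_negf)

text \<open>Rests on \<open>2 * a * (a - b) = (a - b)^2 + (a^2 - b^2)\<close>: the difference of
  squares sums to zero by balance.\<close>

lemma sum_mult_control:
  assumes "weighted_digraph E W" "weight_balanced E W"
  shows "(\<Sum>i\<in>UNIV. v $ i * control E W v i) = - (\<Sum>i\<in>UNIV. phi E W v i) / 2"
proof -
  have "2 * (v $ i * control E W v i) =
      - phi E W v i - (\<Sum>j\<in>UNIV. W $ i $ j * ((v $ i)\<^sup>2 - (v $ j)\<^sup>2))" for i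
    unfolding control_eq_sum[OF assms(1)] phi_eq_sum[OF assms(1)]
    by (simp add: sum_distrib_left sum_negf[symmetric] sum_subtractf[symmetric])
       (rule sum.cong, auto simp: power2_eq_square algebra_simps)
  then have "2 * (\<Sum>i\<in>UNIV. v $ i * control E W v i) =
      - (\<Sum>i\<in>UNIV. phi E W v i) - (\<Sum>i\<in>UNIV. \<Sum>j\<in>UNIV. W $ i $ j * ((v $ i)\<^sup>2 - (v $ j)\<^sup>2))"
    by (simp add: sum_distrib_left sum_subtractf sum_negf)
  then show ?thesis
    using weight_balanced_sum_diff[OF assms, of "\<lambda>i. (v $ i)\<^sup>2"] by simp
qed

section \<open>Estimates for a single agent\<close>

lemma control_power2_le:
  assumes wd: "weighted_digraph E W"
  shows "(control E W v i)\<^sup>2 \<le> d_out E W i * phi E W v i"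
proof -
  have w: "W $ i $ j \<ge> 0" for j
    by (rule weighted_digraph_nonneg[OF wd])
  \<comment> \<open>Splitting each weight into two square roots makes the Cauchy-Schwarz factors
    exactly \<open>d_out\<close> and \<open>phi\<close>.\<close>
  have "(\<Sum>j\<in>UNIV. sqrt (W $ i $ j) * (sqrt (W $ i $ j) * (v $ i - v $ j)))\<^sup>2
      \<le> (\<Sum>j\<in>UNIV. (sqrt (W $ i $ j))\<^sup>2) * (\<Sum>j\<in>UNIV. (sqrt (W $ i $ j) * (v $ i - v $ j))\<^sup>2)"
    by (rule Cauchy_Schwarz_ineq_sum)
  then show ?thesis
    using w by (simp add: control_eq_sum[OF wd] phi_eq_sum[OF wd] d_out_eq_sum[OF wd]
        power_mult_distrib mult.assoc[symmetric])
qed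

text \<open>Young's inequality, edge by edge. Its constants suit the trigger condition, which turns
  the first term into at most \<open>\<sigma> i * phi E W v i / 4\<close> in
  \<open>disagreement_step\<close>.\<close>

lemma neg_mult_control_le:
  assumes wd: "weighted_digraph E W"
  shows "- (e * control E W v i) \<le> d_out E W i * e\<^sup>2 + phi E W v i / 4"
proof -
  have "- (e * control E W v i) = (\<Sum>j\<in>UNIV. W $ i $ j * (e * (v $ i - v $ j)))"
    by (simp add: control_eq_sum[OF wd] sum_distrib_left mult.left_commute)
  also have "\<dots> \<le> (\<Sum>j\<in>UNIV. W $ i $ j * (e\<^sup>2 + (v $ i - v $ j)\<^sup>2 / 4))"
  proof (intro sum_mono mult_left_mono weighted_digraph_nonneg[OF wd])
    fix j
    have "0 \<le> (e - (v $ i - v $ j) / 2)\<^sup>2"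
      by simp
    then show "e * (v $ i - v $ j) \<le> e\<^sup>2 + (v $ i - v $ j)\<^sup>2 / 4"
      by (simp add: power2_diff power_divide)
  qed
  also have "\<dots> = d_out E W i * e\<^sup>2 + phi E W v i / 4"
    by (simp add: d_out_eq_sum[OF wd] phi_eq_sum[OF wd] distrib_left sum.distrib
        sum_distrib_right sum_divide_distrib)
  finally show ?thesis .
qed

lemma d_out_le:
  fixes W :: "real^'n^'n::finite"
  assumes wd: "weighted_digraph E W"
  shows "d_out E W i \<le> w_max E W * real (nbrs_max E)"
proof -
  have w_le: "W $ k $ j \<le> w_max E W" if "j \<in> out_nbrs E k" for k j
  proof -
    have "W $ k $ j \<le> (MAX j\<in>out_nbrs E k. W $ k $ j)"
      using that by (intro Max_ge) auto
    also have "\<dots> \<le> w_max E W"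
      unfolding w_max_def by (intro Max_ge) auto
    finally show ?thesis .
  qed
  have card_le: "card (out_nbrs E k) \<le> nbrs_max E" for k
    unfolding nbrs_max_def by (intro Max_ge) auto
  show ?thesis
  proof (cases "nbrs_max E = 0")
    \<comment> \<open>Without edges the inner maxima in \<open>w_max\<close> range over empty sets,
      so its value is unknown; the factor zero absorbs it.\<close>
    case True
    then have "out_nbrs E i = {}"
      using card_le[of i] by simp
    then show ?thesis
      using True by (simp add: d_out_def)
  next
    case False
    \<comment> \<open>A vertex of maximal out-degree supplies an edge, whose weight shows that
      \<open>w_max\<close> is nonnegative. Only then may the degree of \<open>i\<close> be replaced
      by the maximal one.\<close>
    have "nbrs_max E \<in> range (\<lambda>i. card (out_nbrs E i))"
      unfolding nbrs_max_def by (intro Max_in) auto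
    then obtain k where "card (out_nbrs E k) = nbrs_max E"
      by auto
    with False obtain j where "j \<in> out_nbrs E k"
      by fastforce
    then have "w_max E W \<ge> 0"
      using w_le[of j k] weighted_digraph_nonneg[OF wd, of k j] by linarith
    have "d_out E W i \<le> real (card (out_nbrs E i)) * w_max E W"
      unfolding d_out_def by (rule sum_bounded_above) (rule w_le)
    also have "\<dots> \<le> real (nbrs_max E) * w_max E W"
      using card_le[of i] \<open>w_max E W \<ge> 0\<close> by (intro mult_right_mono) auto
    finally show ?thesis
      by (simp add: mult.commute)
  qed
qed

section \<open>Connectivity: bounding the disagreement by \<open>phi\<close>\<close>

lemma weighted_edge_le_sum_phi:
  assumes wd: "weighted_digraph E W"
  shows "W $ i $ j * (v $ i - v $ j)\<^sup>2 \<le> (\<Sum>k\<in>UNIV. phi E W v k)"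
proof -
  have "W $ i $ j * (v $ i - v $ j)\<^sup>2 \<le> phi E W v i"
    unfolding phi_eq_sum[OF wd]
    by (rule member_le_sum) (auto intro!: mult_nonneg_nonneg weighted_digraph_nonneg[OF wd])
  also have "\<dots> \<le> (\<Sum>k\<in>UNIV. phi E W v k)"
    by (rule member_le_sum) (auto intro: phi_nonneg[OF wd])
  finally show ?thesis .
qed

lemma power2_add_le: "(a + b)\<^sup>2 \<le> 2 * a\<^sup>2 + 2 * (b::real)\<^sup>2"
  using sum_squares_bound[of a b] by (simp add: power2_sum)

text \<open>Along a path, every further edge doubles the constant and adds twice the reciprocal of
  its weight. \<open>K\<close> is chosen before \<open>v\<close>, so the bound is uniform in the
  broadcast state.\<close>

lemma rtrancl_diff_le_sum_phi:
  assumes wd: "weighted_digraph E W" and "(i, j) \<in> E\<^sup>*"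
  shows "\<exists>K. \<forall>v. (v $ i - v $ j)\<^sup>2 \<le> K * (\<Sum>k\<in>UNIV. phi E W v k)"
  using assms(2)
proof (induction rule: rtrancl_induct)
  case base
  show ?case
    by (rule exI[of _ 0]) simp
next
  case (step j k)
  then obtain K where K: "\<And>v. (v $ i - v $ j)\<^sup>2 \<le> K * (\<Sum>k\<in>UNIV. phi E W v k)"
    by auto
  have "W $ j $ k > 0"
    using step.hyps(2) wd by (simp add: weighted_digraph_def)
  have "(v $ i - v $ k)\<^sup>2 \<le> (2 * K + 2 / W $ j $ k) * (\<Sum>k\<in>UNIV. phi E W v k)" for v
  proof -
    have "(v $ i - v $ k)\<^sup>2 \<le> 2 * (v $ i - v $ j)\<^sup>2 + 2 * (v $ j - v $ k)\<^sup>2"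
      using power2_add_le[of "v $ i - v $ j" "v $ j - v $ k"] by simp
    moreover have "(v $ j - v $ k)\<^sup>2 \<le> (\<Sum>k\<in>UNIV. phi E W v k) / W $ j $ k"
      using weighted_edge_le_sum_phi[OF wd, of j k v] \<open>W $ j $ k > 0\<close>
      by (simp add: pos_le_divide_eq mult.commute)
    ultimately show ?thesis
      using K[of v] by (simp add: algebra_simps)
  qed
  then show ?case
    by blast
qed

definition average :: "real^'n::finite \<Rightarrow> real" where
  "average y = (\<Sum>k\<in>UNIV. y $ k) / real CARD('n)"

text \<open>The Lyapunov function \<open>V\<close> of the overview, centred at the average of
  \<open>y\<close> itself; along the samples that average stays equal to \<open>a\<close>.\<close>

definition disagreement :: "real^'n::finite \<Rightarrow> real" where
  "disagreement y = (\<Sum>i\<in>UNIV. (y $ i - average y)\<^sup>2)"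

lemma disagreement_nonneg: "disagreement y \<ge> 0"
  unfolding disagreement_def by (intro sum_nonneg) simp

text \<open>The mean minimises the sum of squared deviations; the excess is
  \<open>N * (average y - b)^2\<close>. This lets a broadcast value \<open>v $ r\<close> replace the
  average.\<close>

lemma disagreement_le:
  fixes y :: "real^'n::finite"
  shows "disagreement y \<le> (\<Sum>i\<in>UNIV. (y $ i - b)\<^sup>2)"
proof -
  have S: "(\<Sum>i\<in>UNIV. y $ i) = real CARD('n) * average y"
    by (simp add: average_def)
  have "(\<Sum>i\<in>UNIV. (y $ i - b)\<^sup>2) =
      (\<Sum>i\<in>UNIV. (y $ i - average y)\<^sup>2 + 2 * (average y - b) * (y $ i) +
        (b\<^sup>2 - (average y)\<^sup>2))"
    by (rule sum.cong) (auto simp: power2_eq_square algebra_simps)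
  also have "\<dots> = disagreement y + 2 * (average y - b) * (\<Sum>i\<in>UNIV. y $ i) +
      real CARD('n) * (b\<^sup>2 - (average y)\<^sup>2)"
    by (simp add: sum.distrib disagreement_def sum_distrib_left)
  also have "\<dots> = disagreement y + real CARD('n) * (average y - b)\<^sup>2"
    unfolding S by (simp add: power2_eq_square algebra_simps)
  finally show ?thesis
    by simp
qed

text \<open>Split \<open>y $ i - v $ r\<close> at \<open>v $ i\<close>: the trigger condition bounds
  the first part, a path from \<open>i\<close> to \<open>r\<close> the second. \<open>C\<close>
  serves all \<open>y\<close> and \<open>v\<close>, so the later decay factor is the same at every
  sampling instant.\<close>

lemma disagreement_le_sum_phi:
  fixes W :: "real^'n^'n::finite"
  assumes wd: "weighted_digraph E W" and sc: "strongly_connected E"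
  shows "\<exists>C. \<forall>y v. (\<forall>i. trigger_fun E W \<sigma> y v i \<le> 0) \<longrightarrow>
    disagreement y \<le> C * (\<Sum>i\<in>UNIV. phi E W v i)"
proof -
  define r :: 'n where "r = undefined"
  have "\<forall>i. \<exists>K. \<forall>v. (v $ i - v $ r)\<^sup>2 \<le> K * (\<Sum>k\<in>UNIV. phi E W v k)"
    using rtrancl_diff_le_sum_phi[OF wd] sc by (simp add: strongly_connected_def)
  then obtain K where K: "\<And>i v. (v $ i - v $ r)\<^sup>2 \<le> K i * (\<Sum>k\<in>UNIV. phi E W v k)"
    by metis
  \<comment> \<open>The absolute value makes \<open>D i\<close> nonnegative for any sign of
    \<open>\<sigma> i\<close>, so that \<open>phi\<close> at \<open>i\<close> may be enlarged to the
    whole sum.\<close>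
  define D where "D i = \<bar>\<sigma> i / (4 * d_out E W i)\<bar>" for i
  have "disagreement y \<le> (\<Sum>i\<in>UNIV. 2 * D i + 2 * K i) * (\<Sum>i\<in>UNIV. phi E W v i)"
    if trig: "\<forall>i. trigger_fun E W \<sigma> y v i \<le> 0" for y v
  proof -
    have "disagreement y \<le> (\<Sum>i\<in>UNIV. (y $ i - v $ r)\<^sup>2)"
      by (rule disagreement_le)
    also have "\<dots> \<le> (\<Sum>i\<in>UNIV. (2 * D i + 2 * K i) * (\<Sum>i\<in>UNIV. phi E W v i))"
    proof (rule sum_mono)
      fix i
      have "(v $ i - y $ i)\<^sup>2 \<le> \<sigma> i / (4 * d_out E W i) * phi E W v i"
        using trig by (simp add: trigger_fun_def)
      also have "\<dots> \<le> D i * phi E W v i"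
        unfolding D_def by (intro mult_right_mono phi_nonneg[OF wd] abs_ge_self)
      also have "\<dots> \<le> D i * (\<Sum>i\<in>UNIV. phi E W v i)"
        by (intro mult_left_mono member_le_sum) (auto simp: D_def phi_nonneg[OF wd])
      finally have "(y $ i - v $ i)\<^sup>2 \<le> D i * (\<Sum>i\<in>UNIV. phi E W v i)"
        by (simp add: power2_commute)
      then show "(y $ i - v $ r)\<^sup>2 \<le> (2 * D i + 2 * K i) * (\<Sum>i\<in>UNIV. phi E W v i)"
        using K[where i = i and v = v] power2_add_le[of "y $ i - v $ i" "v $ i - v $ r"]
        by (simp add: algebra_simps)
    qed
    also have "\<dots> = (\<Sum>i\<in>UNIV. 2 * D i + 2 * K i) * (\<Sum>i\<in>UNIV. phi E W v i)"
      by (simp add: sum_distrib_right)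
    finally show ?thesis .
  qed
  then show ?thesis
    by blast
qed

section \<open>Decrease over one sampling period\<close>

text \<open>\<open>\<kappa>\<close> is the slack left after paying for outdated broadcasts
  (\<open>\<sigma> i\<close>) and for the quadratic term of a step of length \<open>h\<close>
  (\<open>2 * h * d_out E W i\<close>).\<close>

lemma disagreement_step:
  fixes W :: "real^'n^'n::finite"
  assumes wd: "weighted_digraph E W" and wb: "weight_balanced E W"
    and \<sigma>: "\<And>i. \<sigma> i \<ge> 0" and h: "h \<ge> 0"
    and small: "\<And>i. \<sigma> i + 2 * h * d_out E W i + \<kappa> \<le> 1"
    and trig: "\<And>i. trigger_fun E W \<sigma> y v i \<le> 0"
    and z: "\<And>i. z $ i = y $ i + h * control E W v i"
  shows "disagreement z \<le> disagreement y - h * \<kappa> / 2 * (\<Sum>i\<in>UNIV. phi E W v i)"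
proof -
  define u where "u i = control E W v i" for i
  define p where "p i = phi E W v i" for i
  define a where "a = average y"
  have u0: "(\<Sum>i\<in>UNIV. u i) = 0"
    unfolding u_def by (rule sum_control_eq_0[OF wd wb])
  have vu: "(\<Sum>i\<in>UNIV. v $ i * u i) = - (\<Sum>i\<in>UNIV. p i) / 2"
    unfolding u_def p_def by (rule sum_mult_control[OF wd wb])
  have zu: "z $ i = y $ i + h * u i" for i
    by (simp add: z u_def)
  have az: "average z = a"
    using u0 by (simp add: average_def a_def zu sum.distrib sum_distrib_left[symmetric])
  have eu: "- ((v $ i - y $ i) * u i) \<le> (\<sigma> i + 1) * p i / 4" for i
  proof -
    have "d_out E W i * (v $ i - y $ i)\<^sup>2 \<le> d_out E W i * (\<sigma> i / (4 * d_out E W i) * p i)"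
      using trig[of i] d_out_nonneg[OF wd] unfolding trigger_fun_def p_def
      by (intro mult_left_mono) auto
    \<comment> \<open>\<open>d_out\<close> cancels unless it is zero, and then the left side is
      zero.\<close>
    also have "\<dots> \<le> \<sigma> i * p i / 4"
      using \<sigma>[of i] phi_nonneg[OF wd, of v i] by (cases "d_out E W i = 0") (auto simp: p_def)
    finally show ?thesis
      using neg_mult_control_le[OF wd, of "v $ i - y $ i" v i]
      by (simp add: u_def p_def algebra_simps)
  qed
  \<comment> \<open>In the cross term \<open>2 * h * (y $ i - a) * u i\<close>, writing
    \<open>y $ i\<close> as \<open>v $ i - (v $ i - y $ i)\<close> leaves one piece each for
    \<open>vu\<close>, \<open>eu\<close> and \<open>u0\<close>.\<close>
  have "disagreement z =
      (\<Sum>i\<in>UNIV. (y $ i - a)\<^sup>2 + 2 * h * (v $ i * u i) + 2 * h * (- ((v $ i - y $ i) * u i)) -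
        2 * h * a * u i + h\<^sup>2 * (u i)\<^sup>2)"
    unfolding disagreement_def az
    by (rule sum.cong) (auto simp: zu power2_eq_square algebra_simps)
  also have "\<dots> \<le> (\<Sum>i\<in>UNIV. (y $ i - a)\<^sup>2 + 2 * h * (v $ i * u i) +
      2 * h * ((\<sigma> i + 1) * p i / 4) - 2 * h * a * u i + h\<^sup>2 * (d_out E W i * p i))"
    using h eu control_power2_le[OF wd, of v]
    by (intro sum_mono add_mono diff_mono order_refl mult_left_mono[where c = "2 * h"]
        mult_left_mono[where c = "h\<^sup>2"]) (auto simp: u_def p_def)
  also have "\<dots> = disagreement y + 2 * h * (\<Sum>i\<in>UNIV. v $ i * u i) - 2 * h * a * (\<Sum>i\<in>UNIV. u i)
      + (\<Sum>i\<in>UNIV. 2 * h * ((\<sigma> i + 1) * p i / 4) + h\<^sup>2 * (d_out E W i * p i))"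
    unfolding disagreement_def a_def[symmetric]
    by (simp add: sum.distrib sum_subtractf sum_distrib_left)
  also have "\<dots> = disagreement y +
      (\<Sum>i\<in>UNIV. - h * p i + 2 * h * ((\<sigma> i + 1) * p i / 4) + h\<^sup>2 * (d_out E W i * p i))"
    unfolding vu u0 by (simp add: sum.distrib sum_subtractf sum_distrib_left[symmetric] sum_negf)
  also have "\<dots> \<le> disagreement y + (\<Sum>i\<in>UNIV. - (h * \<kappa> / 2) * p i)"
  proof (intro add_left_mono sum_mono)
    fix i
    \<comment> \<open>The total coefficient of \<open>p i\<close> is
      \<open>- (h / 2) * (1 - \<sigma> i - 2 * h * d_out E W i)\<close>, and \<open>small\<close>
      bounds the last factor below by \<open>\<kappa>\<close>.\<close>
    have "(h * p i / 2) * (\<sigma> i + 2 * h * d_out E W i + \<kappa>) \<le> (h * p i / 2) * 1"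
      using small[of i] h phi_nonneg[OF wd, of v i] by (intro mult_left_mono) (auto simp: p_def)
    then show "- h * p i + 2 * h * ((\<sigma> i + 1) * p i / 4) + h\<^sup>2 * (d_out E W i * p i)
        \<le> - (h * \<kappa> / 2) * p i"
      by (simp add: power2_eq_square algebra_simps add_divide_distrib)
  qed
  also have "\<dots> = disagreement y - h * \<kappa> / 2 * (\<Sum>i\<in>UNIV. phi E W v i)"
    by (simp add: p_def sum_distrib_left sum_negf)
  finally show ?thesis .
qed

section \<open>From sampling instants to continuous time\<close>

text \<open>The derivative is known only inside the interval; continuity carries the formula to both
  ends, so it yields the next sample although the control may jump there.\<close>

lemma single_integrator_affine:
  assumes "single_integrator h x u" and h: "h > 0"
    and u: "\<And>t. t \<in> {real l * h..<real (Suc l) * h} \<Longrightarrow> u t = c"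
    and t: "t \<in> {real l * h..real (Suc l) * h}"
  shows "x t $ i = x (real l * h) $ i + (t - real l * h) * c i"
proof (cases "t = real l * h")
  case False
  define g where "g s = x s $ i - s * c i" for s
  have "continuous_on {0..} x"
    and der: "\<And>s. s \<in> {real l * h<..<real (Suc l) * h} \<Longrightarrow>
      ((\<lambda>s. x s $ i) has_real_derivative u s i) (at s)"
    using assms(1) unfolding single_integrator_def by blast+
  then have "continuous_on {real l * h..t} g"
    unfolding g_def using h
    by (intro continuous_intros continuous_on_subset[OF \<open>continuous_on {0..} x\<close>])
       (auto intro: order_trans[rotated])
  moreover have "(g has_real_derivative 0) (at s)" if "real l * h < s" "s < t" for s
  proof -
    have "s \<in> {real l * h<..<real (Suc l) * h}"
      using that t by auto
    moreover from this have "u s = c"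
      by (intro u) auto
    ultimately have "((\<lambda>s. x s $ i) has_real_derivative c i) (at s)"
      using der by metis
    then show ?thesis
      unfolding g_def by (auto intro!: derivative_eq_intros)
  qed
  ultimately have "g t = g (real l * h)"
    using False t by (intro DERIV_isconst_end) auto
  then show ?thesis
    by (simp add: g_def algebra_simps)
qed simp

text \<open>For \<open>l\<close> the floor of \<open>t / h\<close>, \<open>t / h < l + 1\<close>
  gives \<open>q ^ (l + 1) \<le> exp (ln q / h * t)\<close>; passing to \<open>q ^ l\<close> costs
  the factor \<open>1 / q\<close>.\<close>

lemma geometric_samples_imp_exp_decay:
  fixes V :: "real \<Rightarrow> real" and q h :: real
  assumes h: "h > 0" and q: "0 < q" "q < 1" and M: "M \<ge> 0"
    and V: "\<And>l t. t \<in> {real l * h..<real (Suc l) * h} \<Longrightarrow> V t \<le> M * q ^ l"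
    and t: "t \<ge> 0"
  shows "V t \<le> M / q * exp (ln q / h * t)"
proof -
  define l where "l = nat \<lfloor>t / h\<rfloor>"
  have "t / h \<ge> 0"
    using h t by simp
  then have "real l \<le> t / h" "t / h < real l + 1"
    unfolding l_def by linarith+
  then have l: "t \<in> {real l * h..<real (Suc l) * h}" "t < (real l + 1) * h"
    using h by (auto simp: field_simps)
  have "ln q < 0"
    using q by simp
  then have "real (Suc l) * ln q \<le> t / h * ln q"
    using \<open>t / h < real l + 1\<close> by (intro mult_right_mono_neg) auto
  moreover have "q ^ Suc l = exp (real (Suc l) * ln q)"
    using q by (simp only: exp_of_nat_mult exp_ln)
  ultimately have "q ^ Suc l \<le> exp (ln q / h * t)"
    by (simp add: mult.commute)
  then have "q ^ l \<le> exp (ln q / h * t) / q"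
    using q by (simp add: field_simps)
  then have "M * q ^ l \<le> M * (exp (ln q / h * t) / q)"
    using M by (intro mult_left_mono)
  then show ?thesis
    using V[OF l(1)] by simp
qed

section \<open>Exponential convergence\<close>

theorem theorem6p1:
  fixes E :: "('n::finite \<times> 'n) set" and W :: "real^'n^'n"
    and \<sigma> :: "'n \<Rightarrow> real" and h :: real
    and x xh :: "real \<Rightarrow> real^'n" and xh0 :: "real^'n"
  assumes "weighted_digraph E W"
    and "weight_balanced E W"
    and "strongly_connected E"
    and "\<And>i. 0 < \<sigma> i \<and> \<sigma> i < 1"
    and "h > 0"
    and "(MAX i\<in>UNIV. \<sigma> i) + 4 * h * w_max E W * real (nbrs_max E) < 1"
    and "single_integrator h x (\<lambda>t. control E W (xh t))"
    and "periodic_event_triggered_law E W \<sigma> h xh0 x xh"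
  shows "exp_converges_to_average x"
proof -
  note wd = assms(1) and wb = assms(2) and \<sigma> = assms(4) and h = assms(5)
  define X where "X l = x (real l * h)" for l
  define v where "v l = xh (real l * h)" for l
  define a where "a = average (x 0)"
  define \<kappa> where "\<kappa> = 1 - (MAX i\<in>UNIV. \<sigma> i) - 4 * h * w_max E W * real (nbrs_max E)"
  have \<kappa>: "\<kappa> > 0"
    using assms(6) by (simp add: \<kappa>_def)
  have small: "\<sigma> i + 2 * h * d_out E W i + \<kappa> \<le> 1" for i
  proof -
    have "\<sigma> i \<le> (MAX i\<in>UNIV. \<sigma> i)"
      by (intro Max_ge) auto
    moreover have "2 * h * d_out E W i \<le> 4 * h * (w_max E W * real (nbrs_max E))"
      using h d_out_nonneg[OF wd] d_out_le[OF wd] by (intro mult_mono) auto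
    ultimately show ?thesis
      unfolding \<kappa>_def mult.assoc by linarith
  qed
  \<comment> \<open>The law states the update at time 0 separately, hence the case distinction on
    \<open>l\<close>.\<close>
  have trig: "trigger_fun E W \<sigma> (X l) (v l) i \<le> 0" for l i
    using assms(8) unfolding periodic_event_triggered_law_def sampling_update_def X_def v_def
    by (cases l) auto
  have affine: "x t $ i = X l $ i + (t - real l * h) * control E W (v l) i"
    if "t \<in> {real l * h..real (Suc l) * h}" for l t i
    unfolding X_def
  proof (rule single_integrator_affine[OF assms(7) h _ that])
    fix s
    assume "s \<in> {real l * h..<real (Suc l) * h}"
    then have "xh s = v l"
      using assms(8) unfolding periodic_event_triggered_law_def v_def by blast
    then show "control E W (xh s) = control E W (v l)"
      by simp
  qed
  have step: "X (Suc l) $ i = X l $ i + h * control E W (v l) i" for l i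
  proof -
    have "real (Suc l) * h \<in> {real l * h..real (Suc l) * h}"
      using h by simp
    from affine[OF this] show ?thesis
      by (simp add: X_def algebra_simps)
  qed
  have avg: "average (X l) = a" for l
  proof (induction l)
    case (Suc l)
    then show ?case
      using sum_control_eq_0[OF wd wb, of "v l"]
      by (simp add: average_def step sum.distrib sum_distrib_left[symmetric])
  qed (simp add: X_def a_def)

  obtain C0 where C0: "\<And>y v. (\<forall>i. trigger_fun E W \<sigma> y v i \<le> 0) \<Longrightarrow>
      disagreement y \<le> C0 * (\<Sum>i\<in>UNIV. phi E W v i)"
    using disagreement_le_sum_phi[OF wd assms(3)] by blast
  \<comment> \<open>\<open>C\<close> dominates \<open>C0\<close>, and the summand
    \<open>h * \<kappa>\<close> makes it positive and keeps \<open>q\<close> at least 1/2.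
    \<open>q\<close> combines the drop \<open>h * \<kappa> / 2 * \<Phi>\<close> with the bound of
    the disagreement by \<open>C * \<Phi>\<close>.\<close>
  define C where "C = \<bar>C0\<bar> + h * \<kappa>"
  define q where "q = 1 - h * \<kappa> / (2 * C)"
  have hk: "h * \<kappa> > 0"
    using h \<kappa> by simp
  moreover have "h * \<kappa> \<le> C"
    by (simp add: C_def)
  ultimately have C: "C > 0" "h * \<kappa> < 2 * C"
    by linarith+
  then have q: "0 < q" "q < 1"
    using hk by (auto simp: q_def)
  have contract: "disagreement (X (Suc l)) \<le> q * disagreement (X l)" for l
  proof -
    define \<Phi> where "\<Phi> = (\<Sum>i\<in>UNIV. phi E W (v l) i)"
    have "\<Phi> \<ge> 0"
      unfolding \<Phi>_def by (intro sum_nonneg phi_nonneg[OF wd])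
    have "disagreement (X l) \<le> C0 * \<Phi>"
      using C0 trig unfolding \<Phi>_def by blast
    also have "\<dots> \<le> C * \<Phi>"
      using \<open>\<Phi> \<ge> 0\<close> hk by (intro mult_right_mono) (auto simp: C_def)
    finally have "disagreement (X l) / C \<le> \<Phi>"
      using C(1) by (simp add: pos_divide_le_eq mult.commute)
    then have "h * \<kappa> / 2 * (disagreement (X l) / C) \<le> h * \<kappa> / 2 * \<Phi>"
      using hk by (intro mult_left_mono) auto
    moreover have "disagreement (X (Suc l)) \<le> disagreement (X l) - h * \<kappa> / 2 * \<Phi>"
      unfolding \<Phi>_def
      by (rule disagreement_step[OF wd wb _ _ small trig step]) (use \<sigma> h in \<open>auto intro: less_imp_le\<close>)
    moreover have "q * disagreement (X l) =
        disagreement (X l) - h * \<kappa> / 2 * (disagreement (X l) / C)"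
      by (simp add: q_def algebra_simps)
    ultimately show ?thesis
      by linarith
  qed
  have geometric: "disagreement (X l) \<le> disagreement (x 0) * q ^ l" for l
  proof (induction l)
    case (Suc l)
    have "disagreement (X (Suc l)) \<le> q * disagreement (X l)"
      by (rule contract)
    also have "\<dots> \<le> q * (disagreement (x 0) * q ^ l)"
      using Suc q by (intro mult_left_mono) auto
    finally show ?case
      by (simp add: mult_ac)
  qed (simp add: X_def)
  \<comment> \<open>The disagreement never increases from one sample to the next, so its value at
    the left sample controls both ends of a period.\<close>
  have near: "\<bar>X k $ i - a\<bar> \<le> sqrt (disagreement (X l))" if "k = l \<or> k = Suc l" for k l i
  proof -
    have "(X k $ i - a)\<^sup>2 \<le> disagreement (X k)"
      unfolding disagreement_def avg by (rule member_le_sum) auto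
    also have "\<dots> \<le> disagreement (X l)"
      using that
    proof
      assume "k = Suc l"
      have "q * disagreement (X l) \<le> disagreement (X l)"
        using q disagreement_nonneg by (intro mult_left_le_one_le) auto
      then show ?thesis
        using contract[of l] \<open>k = Suc l\<close> by simp
    qed simp
    finally show ?thesis
      by (metis real_sqrt_abs real_sqrt_le_iff)
  qed
  have between: "(x t $ i - a)\<^sup>2 \<le> disagreement (x 0) * q ^ l"
    if t: "t \<in> {real l * h..<real (Suc l) * h}" for l t i
  proof -
    \<comment> \<open>The elapsed fraction of the period, which is the weight of the right sample in
      the convex combination.\<close>
    define r where "r = (t - real l * h) / h"
    have r: "0 \<le> r" "r \<le> 1" "t - real l * h = r * h"
      using t h by (auto simp: r_def field_simps)
    have "x t $ i = X l $ i + (t - real l * h) * control E W (v l) i"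
      using t by (intro affine) auto
    then have "x t $ i - a = (1 - r) * (X l $ i - a) + r * (X (Suc l) $ i - a)"
      unfolding step r(3) by (simp add: algebra_simps)
    also have "\<bar>\<dots>\<bar> \<le> (1 - r) * \<bar>X l $ i - a\<bar> + r * \<bar>X (Suc l) $ i - a\<bar>"
      using r by (intro order_trans[OF abs_triangle_ineq]) (simp add: abs_mult)
    also have "\<dots> \<le> (1 - r) * sqrt (disagreement (X l)) + r * sqrt (disagreement (X l))"
      using r near by (intro add_mono mult_left_mono) auto
    also have "\<dots> = sqrt (disagreement (X l))"
      by (simp add: algebra_simps)
    finally have "(x t $ i - a)\<^sup>2 \<le> disagreement (X l)"
      using abs_le_square_iff[of "x t $ i - a" "sqrt (disagreement (X l))"]
      by (simp add: disagreement_nonneg)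
    then show ?thesis
      using geometric[of l] by linarith
  qed

  define M where "M = disagreement (x 0) / q"
  \<comment> \<open>The squared error decays at rate \<open>- ln q / h\<close>; the square root
    halves it.\<close>
  define \<alpha> where "\<alpha> = - ln q / (2 * h)"
  have "M \<ge> 0"
    using q by (simp add: M_def disagreement_nonneg)
  have "\<alpha> > 0"
    using q h by (simp add: \<alpha>_def divide_neg_pos)
  have "\<bar>x t $ i - a\<bar> \<le> (sqrt M + 1) * exp (- \<alpha> * t)" if "t \<ge> 0" for t i
  proof -
    have "(x t $ i - a)\<^sup>2 \<le> M * exp (ln q / h * t)"
      unfolding M_def
      by (rule geometric_samples_imp_exp_decay[where V = "\<lambda>t. (x t $ i - a)\<^sup>2",
            OF h q disagreement_nonneg between that])
    also have "\<dots> = (sqrt M * exp (- \<alpha> * t))\<^sup>2"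
      using \<open>M \<ge> 0\<close> h
      by (simp add: power_mult_distrib \<alpha>_def exp_double[symmetric] field_simps)
    finally have "\<bar>x t $ i - a\<bar> \<le> sqrt M * exp (- \<alpha> * t)"
      using abs_le_square_iff[of "x t $ i - a" "sqrt M * exp (- \<alpha> * t)"] \<open>M \<ge> 0\<close> by simp
    \<comment> \<open>The added 1 keeps the constant positive when the agents start in consensus,
      where \<open>M\<close> is zero.\<close>
    also have "\<dots> \<le> (sqrt M + 1) * exp (- \<alpha> * t)"
      by (intro mult_right_mono) auto
    finally show ?thesis .
  qed
  moreover have "sqrt M + 1 > 0"
    using \<open>M \<ge> 0\<close> by (simp add: add_nonneg_pos)
  ultimately show ?thesis
    using \<open>\<alpha> > 0\<close> unfolding exp_converges_to_average_def a_def average_def by blast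
qed

end
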